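(* Let $n,k,d,\delta$ be integers with $\delta>2$, $k\ge 2$ and $d\ge 5$. There exists an optimal quaternary $[n,k,d]$ $(1,\delta)$-LRC code (i.e. locality parameter $r=1$) if and only if one of the following holds: (1) $n=k\delta$, $k\ge2$, $d=\delta$, $\delta\ge5$; (2) $n=(k+1)\delta$, $k\ge2$, $d=2\delta$, $\delta>2$; (3) $n=(k+2)\delta$, $2\le k\le 3$, $d=3\delta$, $\delta>2$; (4) $n=(k+3)\delta$, $2\le k\le 3$, $d=4\delta$, $\delta>2$.
   Context: Quaternary means over $\mathbb{F}_4$. For a linear code $\mathcal C\subseteq\mathbb{F}_q^n$ and $R\subseteq[n]=\{1,\dots,n\}$, $\mathcal C|_R$ is the code obtained by puncturing (deleting) the coordinates outside $R$. An $[n,k,d]$ linear code $\mathcal C$ is an $(r,\delta)$-LRC code if for every $i\in[n]$ there is $R_i\subseteq[n]$ with $i\in R_i$, $|R_i|\le r+\delta-1$, such that $\mathcal C|_{R_i}$ has minimum distance at least $\delta$ (every nonzero word has weight at least $\delta$). Every such code satisfies $d\le n-k+1-(\lceil k/r\rceil-1)(\delta-1)$; it is $d$-optimal if equality holds. An $(r,\delta)$-LRC code is $r$-optimal if it is not an $(r',\delta)$-LRC code for any $1\le r'<r$. "Optimal $(r,\delta)$-LRC code" means an $(r,\delta)$-LRC code that is both $d$-optimal and $r$-optimal, with $d\ge\delta>2$ and $k>r\ge1$. *)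

theory Defs
  imports Complex_Main "HOL-Library.Function_Algebras" "HOL-Library.Cardinality"
begin

(* F^I, for a finite set I of coordinates, is the set of functions nat => F vanishing outside I.
   Words of all lengths share one type; the vector operations are the pointwise ones. *)

definition words :: "nat set \<Rightarrow> (nat \<Rightarrow> 'a::zero) set" where
  "words I = {x. \<forall>i. i \<notin> I \<longrightarrow> x i = 0}"

abbreviation scale_word :: "'a::field \<Rightarrow> (nat \<Rightarrow> 'a) \<Rightarrow> nat \<Rightarrow> 'a" where
  "scale_word \<equiv> (\<lambda>c x i. c * x i)"

global_interpretation word_space: vector_space "scale_word :: 'a::field \<Rightarrow> (nat \<Rightarrow> 'a) \<Rightarrow> nat \<Rightarrow> 'a"
  by unfold_locales (simp_all add: fun_eq_iff algebra_simps)

definition linear_code :: "nat set \<Rightarrow> (nat \<Rightarrow> 'a::field) set \<Rightarrow> bool" where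
  "linear_code I C \<longleftrightarrow> word_space.subspace C \<and> C \<subseteq> words I"

definition hamming_dist :: "(nat \<Rightarrow> 'a) \<Rightarrow> (nat \<Rightarrow> 'a) \<Rightarrow> nat" where
  "hamming_dist x y = card {i. x i \<noteq> y i}"

definition weight :: "(nat \<Rightarrow> 'a::zero) \<Rightarrow> nat" where
  "weight x = card {i. x i \<noteq> 0}"

(* The zero code satisfies this for every t. *)
definition min_dist_ge :: "(nat \<Rightarrow> 'a) set \<Rightarrow> nat \<Rightarrow> bool" where
  "min_dist_ge C t \<longleftrightarrow> (\<forall>x\<in>C. \<forall>y\<in>C. x \<noteq> y \<longrightarrow> t \<le> hamming_dist x y)"

definition min_dist_eq :: "(nat \<Rightarrow> 'a) set \<Rightarrow> nat \<Rightarrow> bool" where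
  "min_dist_eq C d \<longleftrightarrow> min_dist_ge C d \<and> (\<exists>x\<in>C. \<exists>y\<in>C. x \<noteq> y \<and> hamming_dist x y = d)"

lemma min_dist_ge_iff_weight:
  fixes C :: "(nat \<Rightarrow> 'a::field) set"
  assumes "word_space.subspace C"
  shows "min_dist_ge C t \<longleftrightarrow> (\<forall>x\<in>C. x \<noteq> 0 \<longrightarrow> t \<le> weight x)"
proof
  assume "min_dist_ge C t"
  then show "\<forall>x\<in>C. x \<noteq> 0 \<longrightarrow> t \<le> weight x"
    using word_space.subspace_0[OF assms]
    by (fastforce simp: min_dist_ge_def hamming_dist_def weight_def)
next
  assume *: "\<forall>x\<in>C. x \<noteq> 0 \<longrightarrow> t \<le> weight x"
  show "min_dist_ge C t"
    unfolding min_dist_ge_def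
  proof (intro ballI impI)
    fix x y assume "x \<in> C" "y \<in> C" "x \<noteq> y"
    then have "t \<le> weight (x - y)"
      using * word_space.subspace_diff[OF assms] by simp
    then show "t \<le> hamming_dist x y"
      by (simp add: weight_def hamming_dist_def)
  qed
qed

(* Deleting the coordinates outside R: the image of C under the projection onto F^R. *)
definition puncture :: "(nat \<Rightarrow> 'a::zero) set \<Rightarrow> nat set \<Rightarrow> (nat \<Rightarrow> 'a) set" where
  "puncture C R = (\<lambda>x i. if i \<in> R then x i else 0) ` C"

definition nkd_code :: "nat \<Rightarrow> nat \<Rightarrow> nat \<Rightarrow> (nat \<Rightarrow> 'a::field) set \<Rightarrow> bool" where
  "nkd_code n k d C \<longleftrightarrow> linear_code {1..n} C \<and> word_space.dim C = k \<and> min_dist_eq C d"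

definition has_locality :: "nat \<Rightarrow> nat \<Rightarrow> nat \<Rightarrow> (nat \<Rightarrow> 'a::field) set \<Rightarrow> bool" where
  "has_locality n r \<delta> C \<longleftrightarrow>
     (\<forall>i\<in>{1..n}. \<exists>R\<subseteq>{1..n}. i \<in> R \<and> card R \<le> r + \<delta> - 1 \<and> min_dist_ge (puncture C R) \<delta>)"

definition LRC_code :: "nat \<Rightarrow> nat \<Rightarrow> nat \<Rightarrow> nat \<Rightarrow> nat \<Rightarrow> (nat \<Rightarrow> 'a::field) set \<Rightarrow> bool" where
  "LRC_code n k d r \<delta> C \<longleftrightarrow> nkd_code n k d C \<and> has_locality n r \<delta> C"

definition d_optimal :: "nat \<Rightarrow> nat \<Rightarrow> nat \<Rightarrow> nat \<Rightarrow> nat \<Rightarrow> bool" where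
  "d_optimal n k d r \<delta> \<longleftrightarrow>
     int d = int n - int k + 1 - (\<lceil>real k / real r\<rceil> - 1) * (int \<delta> - 1)"

definition r_optimal :: "nat \<Rightarrow> nat \<Rightarrow> nat \<Rightarrow> nat \<Rightarrow> nat \<Rightarrow> (nat \<Rightarrow> 'a::field) set \<Rightarrow> bool" where
  "r_optimal n k d r \<delta> C \<longleftrightarrow> \<not> (\<exists>r'. 1 \<le> r' \<and> r' < r \<and> LRC_code n k d r' \<delta> C)"

definition optimal_LRC_code :: "nat \<Rightarrow> nat \<Rightarrow> nat \<Rightarrow> nat \<Rightarrow> nat \<Rightarrow> (nat \<Rightarrow> 'a::field) set \<Rightarrow> bool" where
  "optimal_LRC_code n k d r \<delta> C \<longleftrightarrow>
     d \<ge> \<delta> \<and> \<delta> > 2 \<and> k > r \<and> r \<ge> 1 \<and>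
     LRC_code n k d r \<delta> C \<and> d_optimal n k d r \<delta> \<and> r_optimal n k d r \<delta> C"

end

(* Since |R_i| <= delta, the code punctured to R_i is a repetition code as soon as coordinate i is
   not identically zero.  So the nonzero coordinates split into classes of size >= delta on which all
   codewords have the same zeros.  Any k - 1 classes lie in the zero set of a nonzero codeword, and
   d-optimality bounds every zero set by (k - 1) delta; hence all classes have size exactly delta,
   there are no zero coordinates, and one representative per class carries an MDS code of length
   n / delta.  Conversely, repeating each coordinate of an MDS code delta times gives an optimal code.
   Over F_4, MDS codes of dimension 2 and 3 have length at most 5 and 6 (attained by the hyperoval
   code [6,3,4] and its shortening), and those of dimension k >= 4 have length at most k + 1,
   because shortening reduces to a [6,4,3] code, which violates the Hamming bound. *)

theory Submission
  imports Defs "HOL-Library.FuncSet"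
begin

section \<open>Counting in word spaces\<close>

text \<open>A vector outside the span multiplies its size by q, because \<open>(c, x)\<close> can be
  recovered from \<open>c a + x\<close>.\<close>

lemma card_span_independent:
  fixes B :: "(nat \<Rightarrow> 'a::field) set"
  assumes "finite (UNIV :: 'a set)" "finite B" "\<not> word_space.dependent B"
  shows "card (word_space.span B) = CARD('a) ^ card B"
  using assms(2,3)
proof (induction B)
  case empty
  then show ?case by simp
next
  case (insert a B)
  have ind: "\<not> word_space.dependent B" and a: "a \<notin> word_space.span B"
    using insert word_space.independent_insert[of a B] by auto
  define f where "f = (\<lambda>(c, x). scale_word c a + x)"
  have "inj_on f (UNIV \<times> word_space.span B)"
  proof (rule inj_onI, clarsimp simp: f_def)
    fix c x c' x'
    assume x: "x \<in> word_space.span B" "x' \<in> word_space.span B"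
      and eq: "scale_word c a + x = scale_word c' a + x'"
    have "scale_word (c - c') a = x' - x"
      using eq by (auto simp: fun_eq_iff algebra_simps)
    then have "scale_word (c - c') a \<in> word_space.span B"
      using x word_space.span_diff by metis
    then have "scale_word (inverse (c - c')) (scale_word (c - c') a) \<in> word_space.span B"
      by (rule word_space.span_scale)
    then have "c = c'"
      using a by (cases "c = c'") (simp_all add: mult.assoc[symmetric])
    then show "c = c' \<and> x = x'" using eq by simp
  qed
  moreover have "f ` (UNIV \<times> word_space.span B) = word_space.span (insert a B)"
  proof (intro equalityI subsetI)
    fix y assume "y \<in> f ` (UNIV \<times> word_space.span B)"
    then obtain c x where "y = scale_word c a + x" "x \<in> word_space.span B"
      by (auto simp: f_def)
    then show "y \<in> word_space.span (insert a B)"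
      by (auto simp: word_space.span_breakdown_eq intro!: exI[of _ c])
  next
    fix y assume "y \<in> word_space.span (insert a B)"
    then obtain c where "y - scale_word c a \<in> word_space.span B"
      by (auto simp: word_space.span_breakdown_eq)
    then show "y \<in> f ` (UNIV \<times> word_space.span B)"
      by (auto simp: f_def intro!: image_eqI[of _ _ "(c, y - scale_word c a)"])
  qed
  ultimately have "card (word_space.span (insert a B)) = card ((UNIV :: 'a set) \<times> word_space.span B)"
    by (metis card_image)
  then show ?case
    using insert ind by (simp add: card_cartesian_product)
qed

text \<open>Turns the dimension in the definition of a code into a cardinality; later dimension
  arguments are counts.\<close>

lemma card_subspace:
  fixes C :: "(nat \<Rightarrow> 'a::field) set"
  assumes "finite (UNIV :: 'a set)" "word_space.subspace C" "finite C"
  shows "card C = CARD('a) ^ word_space.dim C"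
proof -
  obtain B where B: "B \<subseteq> C" "\<not> word_space.dependent B" "C \<subseteq> word_space.span B"
      "card B = word_space.dim C"
    using word_space.basis_exists by blast
  have "word_space.span B = C"
    using word_space.span_minimal[OF B(1) assms(2)] B(3) by (rule subset_antisym)
  then show ?thesis
    using card_span_independent[of B] B assms finite_subset by metis
qed

lemma card_words:
  assumes "finite (UNIV :: 'a::zero set)" "finite I"
  shows "finite (words I :: (nat \<Rightarrow> 'a) set)" "card (words I :: (nat \<Rightarrow> 'a) set) = CARD('a) ^ card I"
proof -
  \<comment> \<open>Words are 0 off \<open>I\<close>, extensional functions are
    \<open>undefined\<close> there; the bijection exchanges the two defaults.\<close>
  have "bij_betw (\<lambda>x. restrict x I) (words I) (I \<rightarrow>\<^sub>E (UNIV :: 'a set))"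
    by (rule bij_betw_byWitness[where f' = "\<lambda>y i. if i \<in> I then y i else 0"])
      (auto simp: words_def fun_eq_iff PiE_iff extensional_def)
  moreover have "finite (I \<rightarrow>\<^sub>E (UNIV :: 'a set))"
    using assms by (simp add: finite_PiE)
  ultimately show "finite (words I :: (nat \<Rightarrow> 'a) set)" "card (words I :: (nat \<Rightarrow> 'a) set) = CARD('a) ^ card I"
    using assms by (auto simp: bij_betw_finite bij_betw_same_card card_funcsetE)
qed

lemma subspace_words: "word_space.subspace (words I)"
  by (auto simp: word_space.subspace_def words_def)

text \<open>Fibres of an additive map are translates of subsets of its kernel.\<close>

lemma card_le_kernel:
  fixes C :: "(nat \<Rightarrow> 'a::field) set" and f :: "(nat \<Rightarrow> 'a) \<Rightarrow> 'b::ab_group_add"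
  assumes sub: "word_space.subspace C" and fin: "finite C" and V: "finite V" "f ` C \<subseteq> V"
    and add: "\<And>x y. f (x - y) = f x - f y"
  shows "card C \<le> card V * card {x \<in> C. f x = 0}"
proof -
  have le: "card {x \<in> C. f x = v} \<le> card {x \<in> C. f x = 0}" for v
  proof (cases "\<exists>z\<in>C. f z = v")
    case True
    then obtain z where z: "z \<in> C" "f z = v" by blast
    then have "(\<lambda>x. x - z) ` {x \<in> C. f x = v} \<subseteq> {x \<in> C. f x = 0}"
      using add sub by (auto simp: word_space.subspace_diff)
    moreover have "inj_on (\<lambda>x. x - z) {x \<in> C. f x = v}" by (auto simp: inj_on_def)
    ultimately show ?thesis using fin by (intro card_inj_on_le) auto
  next
    case False
    then have "{x \<in> C. f x = v} = {}" by auto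
    then show ?thesis by (metis card.empty le0)
  qed
  have "C = (\<Union>v\<in>V. {x \<in> C. f x = v})" using V by auto
  then have "card C \<le> (\<Sum>v\<in>V. card {x \<in> C. f x = v})"
    using card_UN_le[OF V(1), of "\<lambda>v. {x \<in> C. f x = v}"] by simp
  also have "\<dots> \<le> (\<Sum>v\<in>V. card {x \<in> C. f x = 0})" by (intro sum_mono le)
  finally show ?thesis by simp
qed

section \<open>MDS codes\<close>

text \<open>For \<open>k \<le> card J\<close>, restriction to \<open>J\<close> embeds
  \<open>C\<close> as an MDS code of dimension \<open>k\<close>: fewer than \<open>k\<close> zeros
  means weight at least \<open>card J - k + 1\<close> on \<open>J\<close>. Words may be nonzero off
  \<open>J\<close>, so puncturing shrinks \<open>J\<close> and keeps \<open>C\<close>.\<close>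

definition mds_on :: "nat set \<Rightarrow> nat \<Rightarrow> (nat \<Rightarrow> 'a::field) set \<Rightarrow> bool" where
  "mds_on J k C \<longleftrightarrow> word_space.subspace C \<and> finite C \<and> CARD('a) ^ k \<le> card C \<and> finite J \<and>
     (\<forall>x\<in>C. x \<noteq> 0 \<longrightarrow> card {j \<in> J. x j = 0} < k)"

lemma mds_on_mono:
  assumes "mds_on J k C" "J' \<subseteq> J"
  shows "mds_on J' k C"
proof -
  have "card {j \<in> J'. x j = 0} \<le> card {j \<in> J. x j = 0}" for x
    using assms by (intro card_mono) (auto simp: mds_on_def)
  then show ?thesis
    using assms by (auto simp: mds_on_def intro: finite_subset le_less_trans)
qed

text \<open>Pigeonhole: restriction to \<open>T\<close> takes fewer values than \<open>C\<close> has
  words, so its kernel is nontrivial.\<close>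

lemma vanishing_word:
  fixes C :: "(nat \<Rightarrow> 'a::field) set"
  assumes q: "finite (UNIV :: 'a set)"
    and C: "word_space.subspace C" "finite C" "CARD('a) ^ k \<le> card C"
    and T: "finite T" "card T < k"
  shows "\<exists>x\<in>C. x \<noteq> 0 \<and> (\<forall>j\<in>T. x j = 0)"
proof (rule ccontr)
  assume *: "\<not> ?thesis"
  define f :: "(nat \<Rightarrow> 'a) \<Rightarrow> nat \<Rightarrow> 'a" where "f x = (\<lambda>j. if j \<in> T then x j else 0)" for x
  have f_0: "f 0 = 0" by (auto simp: f_def fun_eq_iff)
  have "{x \<in> C. f x = 0} = {0}"
  proof (intro equalityI subsetI)
    fix x assume x: "x \<in> {x \<in> C. f x = 0}"
    have "x j = 0" if "j \<in> T" for j
    proof -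
      have "f x j = 0" using x by simp
      then show ?thesis using that by (simp add: f_def)
    qed
    then show "x \<in> {0}" using * x by auto
  qed (use word_space.subspace_0[OF C(1)] f_0 in simp)
  moreover have "card C \<le> card (words T :: (nat \<Rightarrow> 'a) set) * card {x \<in> C. f x = 0}"
    by (rule card_le_kernel[OF C(1,2)])
      (auto simp: f_def words_def fun_eq_iff intro: card_words[unfolded words_def] q T)
  ultimately have "CARD('a) ^ k \<le> CARD('a) ^ card T"
    using C(3) card_words(2)[OF q T(1)] by simp
  moreover have "card {0, 1 :: 'a} \<le> CARD('a)"
    by (rule card_mono[OF q]) simp
  then have "1 < CARD('a)" by simp
  ultimately have "k \<le> card T" by (metis power_le_imp_le_exp)
  then show False using T(2) by simp
qed

text \<open>Any \<open>k\<close> coordinates in \<open>J\<close> determine a codeword; this gives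
  the upper bound matching the lower bound in \<open>mds_on\<close>.\<close>

lemma mds_on_card:
  fixes C :: "(nat \<Rightarrow> 'a::field) set"
  assumes q: "finite (UNIV :: 'a set)" and C: "mds_on J k C" and k: "k \<le> card J"
  shows "card C = CARD('a) ^ k"
proof -
  obtain T where T: "T \<subseteq> J" "card T = k" "finite T"
    using k by (rule obtain_subset_with_card_n)
  define f :: "(nat \<Rightarrow> 'a) \<Rightarrow> nat \<Rightarrow> 'a" where "f x = (\<lambda>j. if j \<in> T then x j else 0)" for x
  have "x = 0" if "x \<in> C" "f x = 0" for x
  proof (rule ccontr)
    assume "x \<noteq> 0"
    moreover have "{j \<in> T. x j = 0} = T" using that(2) by (auto simp: f_def fun_eq_iff split: if_splits)
    moreover have "mds_on T k C" using C T(1) by (rule mds_on_mono)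
    ultimately show False using that(1) T by (auto simp: mds_on_def)
  qed
  then have "{x \<in> C. f x = 0} \<subseteq> {0}" by auto
  then have "card {x \<in> C. f x = 0} \<le> card {0 :: nat \<Rightarrow> 'a}" by (intro card_mono) auto
  moreover have "card C \<le> card (words T :: (nat \<Rightarrow> 'a) set) * card {x \<in> C. f x = 0}"
    using C by (intro card_le_kernel)
      (auto simp: mds_on_def f_def words_def fun_eq_iff intro: card_words[unfolded words_def] q T)
  ultimately have "card C \<le> CARD('a) ^ card T * 1"
    unfolding card_words(2)[OF q T(3)] by (elim order_trans mult_le_mono2) simp
  then have "card C \<le> CARD('a) ^ k" using T(2) by simp
  then show ?thesis using C by (simp add: mds_on_def)
qed

text \<open>Vanishing at \<open>j\<close> costs at most a factor q in size and uses up one of the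
  zeros that a word may have.\<close>

lemma mds_on_shorten:
  fixes C :: "(nat \<Rightarrow> 'a::field) set"
  assumes q: "finite (UNIV :: 'a set)" and C: "mds_on J (Suc k) C" and j: "j \<in> J"
  shows "mds_on (J - {j}) k {x \<in> C. x j = 0}"
proof -
  have sub: "word_space.subspace C" and J: "finite J" using C by (auto simp: mds_on_def)
  have "card C \<le> CARD('a) * card {x \<in> C. x j = 0}"
    using C q by (intro card_le_kernel) (auto simp: mds_on_def)
  then have "CARD('a) * CARD('a) ^ k \<le> CARD('a) * card {x \<in> C. x j = 0}"
    using C unfolding mds_on_def power_Suc by linarith
  then have "CARD('a) ^ k \<le> card {x \<in> C. x j = 0}"
    using finite_UNIV_card_ge_0[OF q] by simp
  moreover have "card {i \<in> J - {j}. x i = 0} < k" if "x \<in> C" "x j = 0" "x \<noteq> 0" for x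
  proof -
    have "{i \<in> J. x i = 0} = insert j {i \<in> J - {j}. x i = 0}" using that j by auto
    then have "card {i \<in> J. x i = 0} = Suc (card {i \<in> J - {j}. x i = 0})" using J by simp
    then show ?thesis using C that by (auto simp: mds_on_def)
  qed
  moreover have "word_space.subspace {x \<in> C. x j = 0}"
    using sub by (auto simp: word_space.subspace_def)
  ultimately show ?thesis using C by (simp add: mds_on_def)
qed

section \<open>Length bounds over a field with four elements\<close>

text \<open>At each coordinate at least 3 nonzero codewords vanish. No nonzero word has two zeros,
  so these sets are disjoint among 15 words.\<close>

lemma mds_on_dim_2_length:
  fixes C :: "(nat \<Rightarrow> 'a::field) set"
  assumes q: "CARD('a) = 4" and C: "mds_on J 2 C"
  shows "card J \<le> 5"
\<comment> \<open>The exact size of \<open>C\<close> from \<open>mds_on_card\<close> requires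
  \<open>2 \<le> card J\<close>.\<close>
proof (cases "card J \<ge> 2")
  case True
  have fin: "finite (UNIV :: 'a set)" using q by (simp add: card_ge_0_finite)
  have sub: "word_space.subspace C" and fC: "finite C" and J: "finite J" using C by (auto simp: mds_on_def)
  define Z where "Z j = {x \<in> C. x \<noteq> 0 \<and> x j = 0}" for j
  have cZ: "3 \<le> card (Z j)" if "j \<in> J" for j
  proof -
    have "mds_on (J - {j}) 1 {x \<in> C. x j = 0}"
      using C that by (intro mds_on_shorten[OF fin]) (auto simp: numeral_2_eq_2)
    then have "4 \<le> card {x \<in> C. x j = 0}" using q by (simp add: mds_on_def)
    moreover have "{x \<in> C. x j = 0} = insert 0 (Z j)"
      using word_space.subspace_0[OF sub] by (auto simp: Z_def)
    moreover have "finite (Z j)" "0 \<notin> Z j" using fC by (auto simp: Z_def)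
    ultimately show ?thesis by simp
  qed
  have disj: "Z i \<inter> Z j = {}" if "i \<in> J" "j \<in> J" "i \<noteq> j" for i j
  proof (rule ccontr)
    assume "Z i \<inter> Z j \<noteq> {}"
    then obtain x where x: "x \<in> C" "x \<noteq> 0" "x i = 0" "x j = 0" by (auto simp: Z_def)
    have "card {i, j} \<le> card {l \<in> J. x l = 0}" using that x J by (intro card_mono) auto
    then show False using C x that by (auto simp: mds_on_def)
  qed
  have "3 * card J \<le> (\<Sum>j\<in>J. card (Z j))" using sum_mono[of J "\<lambda>_. 3" "\<lambda>j. card (Z j)"] cZ by simp
  also have "\<dots> = card (\<Union>j\<in>J. Z j)"
    using J fC disj by (intro card_UN_disjoint[symmetric]) (auto simp: Z_def)
  also have "\<dots> \<le> card (C - {0})" using fC by (intro card_mono) (auto simp: Z_def)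
  also have "\<dots> = 15"
    using mds_on_card[OF fin C True] q word_space.subspace_0[OF sub] by simp
  finally show ?thesis by simp
qed simp

lemma mds_on_dim_3_length:
  fixes C :: "(nat \<Rightarrow> 'a::field) set"
  assumes q: "CARD('a) = 4" and C: "mds_on J 3 C"
  shows "card J \<le> 6"
proof (cases "J = {}")
  case False
  have fin: "finite (UNIV :: 'a set)" using q by (simp add: card_ge_0_finite)
  obtain j where j: "j \<in> J" using False by blast
  have "mds_on (J - {j}) 2 {x \<in> C. x j = 0}"
    using C j by (intro mds_on_shorten[OF fin]) (auto simp: numeral_3_eq_3 numeral_2_eq_2)
  then have "card (J - {j}) \<le> 5" by (rule mds_on_dim_2_length[OF q])
  then show ?thesis using j C by (simp add: mds_on_def)
qed simp

text \<open>The Hamming bound: balls of radius 1 would overlap, since \<open>4 ^ 4 * (1 + 6 * 3) > 4 ^ 6\<close>.\<close>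

lemma no_mds_on_6_4:
  fixes C :: "(nat \<Rightarrow> 'a::field) set"
  assumes q: "CARD('a) = 4" and J: "card J = 6"
  shows "\<not> mds_on J 4 C"
proof
  assume C: "mds_on J 4 C"
  have fin: "finite (UNIV :: 'a set)" using q by (simp add: card_ge_0_finite)
  have sub: "word_space.subspace C" and fC: "finite C" and fJ: "finite J" using C by (auto simp: mds_on_def)
  define unit :: "nat \<times> 'a \<Rightarrow> nat \<Rightarrow> 'a" where "unit = (\<lambda>(j, c) i. if i = j then c else 0)"
  \<comment> \<open>The errors of weight at most 1 on \<open>J\<close>: 1 + 6 * 3 = 19 of
    them.\<close>
  define E where "E = insert 0 (unit ` (J \<times> (UNIV - {0})))"
  \<comment> \<open>Cutting off outside \<open>J\<close> puts every sum into \<open>words J\<close>,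
    although codewords may extend beyond \<open>J\<close>.\<close>
  define f where "f = (\<lambda>(x, e) j. if j \<in> J then x j + e j else 0 :: 'a)"
  have inj_unit: "inj_on unit (J \<times> (UNIV - {0}))"
    by (auto simp: inj_on_def unit_def fun_eq_iff split: if_splits)
  have "unit (j, c) j = c" for j c by (simp add: unit_def)
  then have "0 \<notin> unit ` (J \<times> (UNIV - {0}))"
    by (auto simp: fun_eq_iff) metis
  then have cE: "card E = 19" "finite E"
    using fJ fin J q by (auto simp: E_def card_image[OF inj_unit] card_cartesian_product)
  have supp: "\<exists>j. \<forall>i. i \<noteq> j \<longrightarrow> e i = 0" if "e \<in> E" for e
    using that by (auto simp: E_def unit_def)
  have "inj_on f (C \<times> E)"
  proof (rule inj_onI, clarify)
    fix x e x' e'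
    assume x: "x \<in> C" "x' \<in> C" and e: "e \<in> E" "e' \<in> E" and eq: "f (x, e) = f (x', e')"
    from supp e obtain a b where a: "\<And>i. i \<noteq> a \<Longrightarrow> e i = 0" and b: "\<And>i. i \<noteq> b \<Longrightarrow> e' i = 0"
      by metis
    have sum: "x i + e i = x' i + e' i" if "i \<in> J" for i
      using fun_cong[OF eq, of i] that by (simp add: f_def)
    \<comment> \<open>Colliding codewords agree on \<open>J\<close> except at the two error
      positions, so their difference has at least 4 zeros.\<close>
    have "J - {a, b} \<subseteq> {i \<in> J. (x - x') i = 0}"
      using sum a b by fastforce
    then have "card (J - {a, b}) \<le> card {i \<in> J. (x - x') i = 0}"
      using fJ by (intro card_mono) auto
    moreover have "card J - card {a, b} \<le> card (J - {a, b})"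
      by (rule diff_card_le_card_Diff) simp
    moreover have "card {a, b} \<le> 2" by (simp add: card_insert_if)
    ultimately have "4 \<le> card {i \<in> J. (x - x') i = 0}" using J by simp
    moreover have "x - x' \<in> C" using x sub by (simp add: word_space.subspace_diff)
    ultimately have "x - x' = 0" using C by (fastforce simp: mds_on_def)
    then have xx: "x = x'" by simp
    have "e i = e' i" for i
    proof (cases "i \<in> J")
      case True
      then show ?thesis using sum xx by simp
    next
      case False
      then show ?thesis using e by (auto simp: E_def unit_def split: if_splits)
    qed
    then show "x = x' \<and> e = e'" using xx by auto
  qed
  moreover have "f ` (C \<times> E) \<subseteq> words J" by (auto simp: f_def words_def)
  ultimately have "card (C \<times> E) \<le> card (words J :: (nat \<Rightarrow> 'a) set)"
    using card_words(1)[OF fin fJ] by (intro card_inj_on_le) auto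
  then have "card C * 19 \<le> 4096"
    using card_words(2)[OF fin fJ] J q cE by (simp add: card_cartesian_product)
  moreover have "256 \<le> card C" using C q by (simp add: mds_on_def)
  ultimately show False by simp
qed

text \<open>Shortening lowers dimension and length by one together, so the bound at
  \<open>k = 4\<close> propagates.\<close>

lemma mds_on_length:
  fixes C :: "(nat \<Rightarrow> 'a::field) set"
  assumes q: "CARD('a) = 4" and C: "mds_on J k C" and k: "k \<ge> 4"
  shows "card J \<le> k + 1"
  using k C
proof (induction k arbitrary: J C rule: dec_induct)
  case base
  show ?case
  proof (rule ccontr)
    assume "\<not> ?thesis"
    then have "6 \<le> card J" by simp
    then obtain T where "T \<subseteq> J" "card T = 6"
      by (rule obtain_subset_with_card_n)
    then show False using mds_on_mono[OF base] no_mds_on_6_4[OF q] by blast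
  qed
next
  case (step k)
  have fin: "finite (UNIV :: 'a set)" using q by (simp add: card_ge_0_finite)
  show ?case
  proof (cases "J = {}")
    case False
    then obtain j where j: "j \<in> J" by blast
    have "card (J - {j}) \<le> k + 1"
      using step.IH mds_on_shorten[OF fin step.prems j] by blast
    then show ?thesis using j step.prems by (simp add: mds_on_def)
  qed simp
qed

section \<open>Optimal codes of locality one are repeated MDS codes\<close>

text \<open>A codeword nonzero somewhere on \<open>R\<close> has weight at least
  \<open>\<delta>\<close> there; as \<open>card R \<le> \<delta>\<close>, it has no zero on
  \<open>R\<close>. A word nonzero at \<open>i\<close> forces
  \<open>card R = \<delta>\<close>.\<close>

lemma repair_group_common_zeros:
  fixes C :: "(nat \<Rightarrow> 'a::field) set"
  assumes sub: "word_space.subspace C" and loc: "has_locality n 1 \<delta> C"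
    and i: "i \<in> {1..n}" and nz: "\<exists>x\<in>C. x i \<noteq> 0"
  shows "\<exists>R\<subseteq>{1..n}. card R = \<delta> \<and> (\<forall>y\<in>C. \<forall>j\<in>R. y j = 0 \<longleftrightarrow> y i = 0)"
proof -
  obtain R where R: "R \<subseteq> {1..n}" "i \<in> R" "card R \<le> \<delta>" "min_dist_ge (puncture C R) \<delta>"
    using loc[unfolded has_locality_def, rule_format, OF i] by auto
  have fR: "finite R" using R(1) finite_subset by blast
  have full: "card R = \<delta> \<and> (\<forall>l\<in>R. y l \<noteq> 0)" if y: "y \<in> C" "j \<in> R" "y j \<noteq> 0" for y j
  proof -
    let ?p = "\<lambda>x i. if i \<in> R then x i else 0 :: 'a"
    have "?p y \<in> puncture C R" "?p 0 \<in> puncture C R"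
      using y word_space.subspace_0[OF sub] unfolding puncture_def by blast+
    moreover have "?p y \<noteq> ?p 0" using y by (auto simp: fun_eq_iff)
    ultimately have "\<delta> \<le> hamming_dist (?p y) (?p 0)"
      using R(4) by (auto simp: min_dist_ge_def)
    moreover have "{l. ?p y l \<noteq> ?p 0 l} = {l \<in> R. y l \<noteq> 0}" by auto
    ultimately have "\<delta> \<le> card {l \<in> R. y l \<noteq> 0}" by (simp add: hamming_dist_def)
    moreover have "card {l \<in> R. y l \<noteq> 0} \<le> card R" using fR by (intro card_mono) auto
    ultimately have "card {l \<in> R. y l \<noteq> 0} = card R" "card R = \<delta>" using R(3) by auto
    moreover then have "{l \<in> R. y l \<noteq> 0} = R" using fR by (intro card_subset_eq) auto
    ultimately show ?thesis by auto
  qed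
  show ?thesis using full nz R(1,2) by (intro exI[of _ R]) metis
qed

text \<open>The equation for \<open>n\<close> is d-optimality at r = 1. \<open>J\<close> will hold
  one representative per class of coordinates with common zeros.\<close>

lemma optimal_code_structure:
  fixes C :: "(nat \<Rightarrow> 'a::field) set"
  assumes q: "finite (UNIV :: 'a set)"
    and sub: "word_space.subspace C" and CI: "C \<subseteq> words {1..n}"
    and big: "CARD('a) ^ k \<le> card C" and d: "min_dist_ge C d"
    and loc: "has_locality n 1 \<delta> C" and n: "n = d + (k - 1) * \<delta>" and k: "2 \<le> k" and \<delta>: "0 < \<delta>"
  shows "\<exists>J. n = card J * \<delta> \<and> k \<le> card J \<and> mds_on J k C"
proof -
  have fC: "finite C" using CI card_words(1)[OF q, of "{1..n}"] finite_subset by auto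
  \<comment> \<open>\<open>S\<close> collects the coordinates that are not identically zero, and the
    sets \<open>P i\<close> are the classes.\<close>
  define S where "S = {i \<in> {1..n}. \<exists>x\<in>C. x i \<noteq> 0}"
  define P where "P i = {j \<in> {1..n}. \<forall>x\<in>C. x j = 0 \<longleftrightarrow> x i = 0}" for i
  have fP: "finite (P i)" for i by (simp add: P_def)
  have P_disj: "P i \<inter> P j = {}" if "P i \<noteq> P j" for i j using that by (auto simp: P_def)
  have P_ge: "\<delta> \<le> card (P i)" if i: "i \<in> S" for i
  proof -
    have "i \<in> {1..n}" "\<exists>x\<in>C. x i \<noteq> 0" using i by (auto simp: S_def)
    then obtain R where R: "R \<subseteq> {1..n}" "card R = \<delta>" "\<forall>y\<in>C. \<forall>j\<in>R. y j = 0 \<longleftrightarrow> y i = 0"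
      using repair_group_common_zeros[OF sub loc] by meson
    then have "R \<subseteq> P i" unfolding P_def by blast
    then show ?thesis using R(2) fP card_mono by blast
  qed
  have zeros: "card {i \<in> {1..n}. x i = 0} \<le> (k - 1) * \<delta>" if x: "x \<in> C" "x \<noteq> 0" for x
  proof -
    have "d \<le> weight x" using x d min_dist_ge_iff_weight[OF sub] by blast
    also have "{i. x i \<noteq> 0} = {1..n} - {i \<in> {1..n}. x i = 0}"
      using x(1) CI unfolding words_def by blast
    then have "weight x = n - card {i \<in> {1..n}. x i = 0}"
      by (simp add: weight_def card_Diff_subset subset_eq)
    finally have "d \<le> n - card {i \<in> {1..n}. x i = 0}" .
    moreover have "card {i \<in> {1..n}. x i = 0} \<le> card {1..n}" by (intro card_mono) auto
    ultimately show ?thesis using n by simp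
  qed
  have "\<exists>J\<subseteq>S. inj_on P J \<and> P ` S = P ` J"
    using subset_image_inj[of "P ` S" P S] by auto
  then obtain J where J: "J \<subseteq> S" "inj_on P J" "P ` S = P ` J" by blast
  have fJ: "finite J" using J(1) by (rule finite_subset) (simp add: S_def)
  \<comment> \<open>The classes of \<open>T\<close> and the identically zero coordinates are
    disjoint parts of the zero set of \<open>x\<close>.\<close>
  have bound: "(\<Sum>j\<in>T. card (P j)) + card ({1..n} - S) \<le> (k - 1) * \<delta>"
    if x: "x \<in> C" "x \<noteq> 0" and T: "T \<subseteq> J" "\<forall>j\<in>T. x j = 0" for x T
  proof -
    have fT: "finite T" using T fJ finite_subset by blast
    have TS: "P j \<subseteq> S" if "j \<in> T" for j
    proof -
      have "j \<in> S" using that T(1) J(1) by blast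
      then show ?thesis unfolding P_def S_def by blast
    qed
    have "(\<Sum>j\<in>T. card (P j)) = card (\<Union>j\<in>T. P j)"
    proof (rule card_UN_disjoint[symmetric])
      show "\<forall>i\<in>T. \<forall>j\<in>T. i \<noteq> j \<longrightarrow> P i \<inter> P j = {}"
        using T(1) J(2) P_disj by (meson inj_onD subsetD)
    qed (use fT fP in auto)
    then have "(\<Sum>j\<in>T. card (P j)) + card ({1..n} - S) = card ((\<Union>j\<in>T. P j) \<union> ({1..n} - S))"
      using fT fP TS by (subst card_Un_disjoint) auto
    also have "\<dots> \<le> card {i \<in> {1..n}. x i = 0}"
      using x T by (intro card_mono) (auto simp: P_def S_def)
    finally show ?thesis using zeros[OF x] by simp
  qed
  have lower: "card T * \<delta> \<le> (\<Sum>j\<in>T. card (P j))" if "T \<subseteq> J" for T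
    using sum_mono[of T "\<lambda>_. \<delta>" "\<lambda>j. card (P j)"] P_ge J(1) that by (auto simp: subset_eq)
  have mds: "mds_on J k C"
    unfolding mds_on_def
  proof (intro conjI ballI impI sub fC big fJ)
    fix x assume x: "x \<in> C" "x \<noteq> 0"
    define T where "T = {j \<in> J. x j = 0}"
    have T: "T \<subseteq> J" "\<forall>j\<in>T. x j = 0" by (auto simp: T_def)
    have "card T * \<delta> \<le> (k - 1) * \<delta>"
      using lower[OF T(1)] bound[OF x T] by linarith
    then have "card T \<le> k - 1" using \<delta> by simp
    then show "card {j \<in> J. x j = 0} < k" using k by (simp add: T_def)
  qed
  \<comment> \<open>With fewer than \<open>k\<close> classes, some nonzero codeword would vanish at
    all representatives and hence everywhere.\<close>
  have kJ: "k \<le> card J"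
  proof (rule ccontr)
    assume "\<not> k \<le> card J"
    then obtain x where x: "x \<in> C" "x \<noteq> 0" "\<forall>j\<in>J. x j = 0"
      using vanishing_word[OF q sub fC big fJ] by auto
    have "x i = 0" for i
    proof (cases "i \<in> S")
      case True
      then obtain j where "j \<in> J" "P i = P j" using J(3) by (metis imageE imageI)
      moreover have "i \<in> P i" using True by (auto simp: P_def S_def)
      ultimately show ?thesis using x by (auto simp: P_def)
    next
      case False
      then show ?thesis using x(1) CI by (auto simp: S_def words_def)
    qed
    then show False using x(2) by auto
  qed
  \<comment> \<open>Choose a nonzero codeword vanishing on \<open>P j\<close> and
    \<open>k - 2\<close> further classes. These take at least \<open>(k - 2) * \<delta>\<close>
    zeros, leaving exactly \<open>\<delta>\<close> for \<open>P j\<close> and none for zero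
    coordinates.\<close>
  have tight: "card (P j) = \<delta> \<and> {1..n} - S = {}" if j: "j \<in> J" for j
  proof -
    have "k - 2 \<le> card (J - {j})" using kJ j fJ by simp
    then obtain T where T: "T \<subseteq> J - {j}" "card T = k - 2" "finite T"
      by (rule obtain_subset_with_card_n)
    have c: "card (insert j T) = k - 1" using T k by (subst card_insert_disjoint) auto
    then obtain x where x: "x \<in> C" "x \<noteq> 0" "\<forall>i\<in>insert j T. x i = 0"
      using vanishing_word[OF q sub fC big, of "insert j T"] T k by auto
    have "(\<Sum>i\<in>insert j T. card (P i)) + card ({1..n} - S) \<le> (k - 1) * \<delta>"
      using bound[OF x(1,2), of "insert j T"] x(3) T j by auto
    moreover have "(\<Sum>i\<in>insert j T. card (P i)) = card (P j) + (\<Sum>i\<in>T. card (P i))"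
      using T by (intro sum.insert) auto
    moreover have "card T * \<delta> \<le> (\<Sum>i\<in>T. card (P i))" using lower[of T] T by auto
    moreover have "(k - 1) * \<delta> = \<delta> + card T * \<delta>"
    proof -
      have "k - 1 = Suc (card T)" using T(2) k by simp
      then show ?thesis by simp
    qed
    moreover have "\<delta> \<le> card (P j)" using P_ge j J(1) by auto
    ultimately have "card (P j) = \<delta>" "card ({1..n} - S) = 0" by linarith+
    then show ?thesis by simp
  qed
  have "J \<noteq> {}" using kJ k by auto
  then have S: "S = {1..n}" using tight by (auto simp: S_def)
  have "{1..n} = (\<Union>j\<in>J. P j)"
  proof (intro equalityI subsetI)
    fix i assume i: "i \<in> {1..n}"
    then obtain j where "j \<in> J" "P i = P j" using J(3) S by (metis imageE imageI)
    then show "i \<in> (\<Union>j\<in>J. P j)" using i by (auto simp: P_def)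
  qed (auto simp: P_def)
  then have "n = card (\<Union>j\<in>J. P j)" by (metis card_atLeastAtMost diff_Suc_1)
  also have "\<dots> = (\<Sum>j\<in>J. card (P j))"
  proof (rule card_UN_disjoint)
    show "\<forall>i\<in>J. \<forall>j\<in>J. i \<noteq> j \<longrightarrow> P i \<inter> P j = {}"
      using J(2) P_disj by (meson inj_onD)
  qed (use fJ fP in auto)
  also have "\<dots> = card J * \<delta>" using tight by simp
  finally show ?thesis using kJ mds by blast
qed

section \<open>Repeating an MDS code\<close>

text \<open>Coordinate \<open>i\<close> of the long code copies coordinate
  \<open>(i - 1) div \<delta>\<close>: long coordinates start at 1, those of the MDS code at
  0.\<close>

lemma card_blocks:
  assumes "A \<subseteq> {..<m}" "0 < \<delta>"
  shows "card {i \<in> {1..m * \<delta>}. (i - 1) div \<delta> \<in> A} = card A * \<delta>"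
proof -
  have "bij_betw (\<lambda>(j, t). j * \<delta> + t + 1) (A \<times> {..<\<delta>}) {i \<in> {1..m * \<delta>}. (i - 1) div \<delta> \<in> A}"
  proof (rule bij_betw_byWitness[where f' = "\<lambda>i. ((i - 1) div \<delta>, (i - 1) mod \<delta>)"])
    have "j * \<delta> + t + 1 \<le> m * \<delta>" if "j \<in> A" "t < \<delta>" for j t
    proof -
      have "Suc j \<le> m" using that assms by auto
      then have "Suc j * \<delta> \<le> m * \<delta>" by (rule mult_le_mono1)
      then show ?thesis using that(2) by simp
    qed
    then show "(\<lambda>(j, t). j * \<delta> + t + 1) ` (A \<times> {..<\<delta>}) \<subseteq> {i \<in> {1..m * \<delta>}. (i - 1) div \<delta> \<in> A}"
      using assms by auto
  qed (use assms in auto)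
  then show ?thesis by (auto simp: bij_betw_same_card[symmetric] card_cartesian_product)
qed

text \<open>Repetition multiplies weights by \<open>\<delta>\<close>, and the block of copies
  containing \<open>i\<close> serves as its repair group.\<close>

lemma repeated_mds_code:
  fixes C :: "(nat \<Rightarrow> 'a::field) set"
  assumes q: "finite (UNIV :: 'a set)" and C: "mds_on {..<m} k C"
    and k: "1 \<le> k" "k \<le> m" and \<delta>: "0 < \<delta>"
  shows "\<exists>C' :: (nat \<Rightarrow> 'a) set. LRC_code (m * \<delta>) k ((m - k + 1) * \<delta>) 1 \<delta> C'"
proof -
  have sub: "word_space.subspace C" and fC: "finite C" and big: "CARD('a) ^ k \<le> card C"
    using C by (auto simp: mds_on_def)
  define f :: "(nat \<Rightarrow> 'a) \<Rightarrow> nat \<Rightarrow> 'a"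
    where "f x = (\<lambda>i. if i \<in> {1..m * \<delta>} then x ((i - 1) div \<delta>) else 0)" for x
  define C' where "C' = f ` C"
  have f_diff: "f x - f y = f (x - y)" for x y by (auto simp: f_def fun_eq_iff)
  have f_add: "f x + f y = f (x + y)" for x y by (auto simp: f_def fun_eq_iff)
  have f_scale: "scale_word c (f x) = f (scale_word c x)" for c x by (auto simp: f_def fun_eq_iff)
  have f_0: "f 0 = 0" by (auto simp: f_def fun_eq_iff)
  have sub': "word_space.subspace C'"
    unfolding word_space.subspace_def C'_def
    using sub f_0 f_add f_scale by (auto simp: word_space.subspace_def)
  have wt: "weight (f x) = (m - card {j \<in> {..<m}. x j = 0}) * \<delta>" for x
  proof -
    let ?A = "{..<m} - {j \<in> {..<m}. x j = 0}"
    have "i \<in> {1..m * \<delta>} \<Longrightarrow> (i - 1) div \<delta> < m" for i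
      using \<delta> by (auto simp: div_less_iff_less_mult)
    then have "{i. f x i \<noteq> 0} = {i \<in> {1..m * \<delta>}. (i - 1) div \<delta> \<in> ?A}"
      by (auto simp: f_def split: if_splits)
    then have "weight (f x) = card ?A * \<delta>"
      unfolding weight_def using card_blocks[of ?A m \<delta>] \<delta> by simp
    moreover have "card ?A = m - card {j \<in> {..<m}. x j = 0}"
      by (subst card_Diff_subset) auto
    ultimately show ?thesis by simp
  qed
  have wt_ge: "(m - k + 1) * \<delta> \<le> weight (f x)" if "x \<in> C" "x \<noteq> 0" for x
  proof -
    have "card {j \<in> {..<m}. x j = 0} < k" using that C by (auto simp: mds_on_def)
    then show ?thesis unfolding wt using k by (intro mult_le_mono1) simp
  qed
  have w0: "weight (0 :: nat \<Rightarrow> 'a) = 0" by (simp add: weight_def)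
  have inj: "inj_on f C"
  proof (rule inj_onI)
    fix x y assume xy: "x \<in> C" "y \<in> C" "f x = f y"
    then have "f (x - y) = 0" by (simp add: f_diff[symmetric])
    then have "weight (f (x - y)) = 0" by (simp add: w0)
    then have "x - y = 0"
      using wt_ge[of "x - y"] xy word_space.subspace_diff[OF sub] \<delta> by fastforce
    then show "x = y" by simp
  qed
  have "card C' = CARD('a) ^ k"
    unfolding C'_def using card_image[OF inj] mds_on_card[OF q C] k by simp
  moreover have "card C' = CARD('a) ^ word_space.dim C'"
    using fC by (intro card_subspace q sub') (simp add: C'_def)
  moreover have "card {0, 1 :: 'a} \<le> CARD('a)" by (rule card_mono[OF q]) simp
  ultimately have dim: "word_space.dim C' = k" by (auto dest: power_inject_exp[THEN iffD1, rotated])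
  have md: "min_dist_ge C' ((m - k + 1) * \<delta>)"
    unfolding min_dist_ge_iff_weight[OF sub'] using wt_ge f_0 by (auto simp: C'_def)
  \<comment> \<open>Forcing \<open>k - 1\<close> zeros exhausts the number allowed, so this word
    attains the minimum weight.\<close>
  obtain x where x: "x \<in> C" "x \<noteq> 0" "\<forall>j\<in>{..<k - 1}. x j = 0"
    using vanishing_word[OF q sub fC big, of "{..<k - 1}"] k by auto
  have "card {..<k - 1} \<le> card {j \<in> {..<m}. x j = 0}"
    using x(3) k by (intro card_mono) auto
  moreover have "card {j \<in> {..<m}. x j = 0} < k" using x(1,2) C by (auto simp: mds_on_def)
  ultimately have "card {j \<in> {..<m}. x j = 0} = k - 1" by simp
  then have "weight (f x) = (m - k + 1) * \<delta>" using wt[of x] k by (simp add: Suc_diff_le)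
  moreover have "hamming_dist (f x) 0 = weight (f x)" by (simp add: hamming_dist_def weight_def)
  moreover have "f x \<in> C'" "0 \<in> C'" using x(1) word_space.subspace_0[OF sub'] by (auto simp: C'_def)
  moreover have "f x \<noteq> 0" using calculation(1) w0 \<delta> by auto
  ultimately have "min_dist_eq C' ((m - k + 1) * \<delta>)" using md unfolding min_dist_eq_def by metis
  moreover have "C' \<subseteq> words {1..m * \<delta>}" by (auto simp: C'_def words_def f_def)
  ultimately have nkd: "nkd_code (m * \<delta>) k ((m - k + 1) * \<delta>) C'"
    using dim sub' by (simp add: nkd_code_def linear_code_def)
  have "has_locality (m * \<delta>) 1 \<delta> C'"
    unfolding has_locality_def
  proof
    fix i assume i: "i \<in> {1..m * \<delta>}"
    define R where "R = {l \<in> {1..m * \<delta>}. (l - 1) div \<delta> \<in> {(i - 1) div \<delta>}}"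
    have "(i - 1) div \<delta> < m" using i \<delta> by (auto simp: div_less_iff_less_mult)
    then have cR: "card R = \<delta>" unfolding R_def using \<delta> by (subst card_blocks) auto
    have "min_dist_ge (puncture C' R) \<delta>"
      unfolding min_dist_ge_def
    proof (intro ballI impI)
      fix y z assume yz: "y \<in> puncture C' R" "z \<in> puncture C' R" "y \<noteq> z"
      \<comment> \<open>Codewords are constant on a block, so distinct punctured words differ on all
        of \<open>R\<close>.\<close>
      then obtain a b where a: "y = (\<lambda>l. if l \<in> R then a else 0)" and b: "z = (\<lambda>l. if l \<in> R then b else 0)"
        by (force simp: puncture_def C'_def f_def R_def fun_eq_iff)
      then have "{l. y l \<noteq> z l} = R" using yz(3) by (auto simp: fun_eq_iff)
      then show "\<delta> \<le> hamming_dist y z" by (simp add: hamming_dist_def cR)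
    qed
    then show "\<exists>R\<subseteq>{1..m * \<delta>}. i \<in> R \<and> card R \<le> 1 + \<delta> - 1 \<and> min_dist_ge (puncture C' R) \<delta>"
      using i cR by (intro exI[of _ R]) (auto simp: R_def)
  qed
  then show ?thesis using nkd by (auto simp: LRC_code_def)
qed

section \<open>Existence of the MDS codes\<close>

text \<open>The code of words with coordinate sum 0. A word with \<open>k\<close> zeros would have
  its only nonzero entry equal to that sum.\<close>

lemma parity_mds_on:
  assumes q: "finite (UNIV :: 'a::field set)"
  shows "\<exists>C :: (nat \<Rightarrow> 'a) set. mds_on {..<Suc k} k C"
proof -
  define f where "f x = (\<Sum>i<Suc k. x i)" for x :: "nat \<Rightarrow> 'a"
  define C where "C = {x \<in> words {..<Suc k}. f x = 0}"
  have W: "finite (words {..<Suc k} :: (nat \<Rightarrow> 'a) set)"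
      "card (words {..<Suc k} :: (nat \<Rightarrow> 'a) set) = CARD('a) ^ Suc k"
    using card_words[OF q, of "{..<Suc k}"] by auto
  have "card (words {..<Suc k} :: (nat \<Rightarrow> 'a) set) \<le> CARD('a) * card C"
    unfolding C_def by (rule card_le_kernel) (auto simp: subspace_words W q f_def sum_subtractf)
  then have "CARD('a) ^ k \<le> card C"
    using q by (simp add: W finite_UNIV_card_ge_0)
  moreover have "word_space.subspace C"
    using subspace_words[of "{..<Suc k}", where ?'a = 'a]
    by (auto simp: C_def f_def word_space.subspace_def sum.distrib sum_distrib_left[symmetric]
        simp del: sum.lessThan_Suc)
  moreover have "card {j \<in> {..<Suc k}. x j = 0} < k" if x: "x \<in> C" "x \<noteq> 0" for x
  proof (rule ccontr)
    obtain i where i: "x i \<noteq> 0" using x(2) by (auto simp: fun_eq_iff)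
    have iI: "i < Suc k" using x(1) i by (auto simp: C_def words_def)
    assume "\<not> ?thesis"
    moreover have sub: "{j \<in> {..<Suc k}. x j = 0} \<subseteq> {..<Suc k} - {i}" using i by auto
    moreover have c: "card ({..<Suc k} - {i}) = k" using iI by simp
    ultimately have "{j \<in> {..<Suc k}. x j = 0} = {..<Suc k} - {i}"
      by (intro card_seteq) auto
    then have "f x = (\<Sum>j\<in>{i}. x j)"
      unfolding f_def using iI by (intro sum.mono_neutral_right) auto
    then show False using x(1) i by (simp add: C_def)
  qed
  moreover have "finite C" using W by (simp add: C_def)
  ultimately show ?thesis by (auto simp: mds_on_def)
qed

text \<open>Translation by 1 permutes the field, so summing all elements shows 4 = 0; then 2 * 2 = 0
  gives 2 = 0.\<close>

lemma card_4_char_2: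
  assumes "CARD('a::field) = 4"
  shows "(1 + 1 :: 'a) = 0"
proof -
  have fin: "finite (UNIV :: 'a set)" using assms by (simp add: card_ge_0_finite)
  have "bij (\<lambda>x :: 'a. x + 1)"
    by (rule o_bij[where g = "\<lambda>x. x - 1"]) (auto simp: fun_eq_iff)
  then have "(\<Sum>x::'a\<in>UNIV. x + 1) = (\<Sum>x::'a\<in>UNIV. x)"
    using sum.reindex_bij_betw[of "\<lambda>x::'a. x + 1" UNIV UNIV "\<lambda>x. x"] by simp
  then have "of_nat CARD('a) = (0 :: 'a)"
    by (simp add: sum.distrib)
  then have "(1 + 1) * (1 + 1) = (0 :: 'a)"
    using assms by (simp add: algebra_simps)
  then show ?thesis unfolding mult_eq_0_iff by simp
qed

text \<open>The points \<open>(1, c, c\<^sup>2)\<close> together with \<open>(0, 0, 1)\<close> and \<open>(0, 1, 0)\<close> form a hyperoval: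
  as \<open>c \<mapsto> c\<^sup>2\<close> is injective in characteristic 2, the nucleus \<open>(0, 1, 0)\<close> can be added to the conic.\<close>

lemma hyperoval_zeros:
  fixes h :: "nat \<Rightarrow> 'a::field"
  assumes two: "(1 + 1 :: 'a) = 0" and h: "inj_on h {..<4}" and nz: "(a, b, e) \<noteq> (0, 0, 0)"
    and y: "y = (\<lambda>j. if j < 4 then a + b * h j + e * (h j)^2 else if j = 4 then e else if j = 5 then b else 0)"
  shows "card {j \<in> {..<6}. y j = 0} < 3"
proof (rule ccontr)
  assume "\<not> ?thesis"
  then have "3 \<le> card {j \<in> {..<6}. y j = 0}" by simp
  then obtain T where "T \<subseteq> {j \<in> {..<6}. y j = 0}" "card T = 3"
    by (rule obtain_subset_with_card_n)
  then obtain i j l where ijl: "i \<noteq> j" "i \<noteq> l" "j \<noteq> l" "i < 6" "j < 6" "l < 6"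
      "y i = 0" "y j = 0" "y l = 0"
    by (auto simp: card_3_iff)
  \<comment> \<open>Subtract the two polynomial values and cancel \<open>h i - h j\<close>.\<close>
  have roots2: "b + e * (h i + h j) = 0"
    if "i < 4" "j < 4" "i \<noteq> j" "y i = 0" "y j = 0" for i j
  proof -
    have "y i = a + b * h i + e * (h i)^2" "y j = a + b * h j + e * (h j)^2"
      using that(1,2) by (simp_all add: y)
    then have "(h i - h j) * (b + e * (h i + h j)) = y i - y j"
      by (simp add: algebra_simps power2_eq_square)
    moreover have "h i \<noteq> h j" using h that by (auto simp: inj_on_def)
    ultimately show ?thesis using that by simp
  qed
  \<comment> \<open>Characteristic 2 enters here: \<open>h i + h j\<close> equals
    \<open>h i - h j\<close>.\<close>
  have sum0: "h i + h j \<noteq> 0" if "i < 4" "j < 4" "i \<noteq> j" for i j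
  proof
    assume "h i + h j = 0"
    moreover have "h j + h j = 0" using two by (metis distrib_left mult.right_neutral mult_zero_right)
    ultimately have "h i = h j" by (metis add_right_cancel)
    then show False using h that by (auto simp: inj_on_def)
  qed
  have e0: "e = 0"
    if "i < 4" "j < 4" "i \<noteq> j" "y i = 0" "y j = 0" "b = 0" for i j
    using roots2[OF that(1-5)] sum0[OF that(1-3)] that(6) by simp
  have a0: "a = 0" if "i < 4" "y i = 0" "b = 0" "e = 0" for i
    using that by (simp add: y)
  \<comment> \<open>A quadratic with three roots: subtracting two instances of \<open>roots2\<close>
    isolates \<open>e\<close>.\<close>
  have e3: "e = 0"
    if "i < 4" "j < 4" "l < 4" "i \<noteq> j" "i \<noteq> l" "j \<noteq> l" "y i = 0" "y j = 0" "y l = 0" for i j l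
  proof -
    have "b + e * (h i + h j) = 0" "b + e * (h i + h l) = 0"
      using roots2 that by auto
    moreover have "e * (h j - h l) = (b + e * (h i + h j)) - (b + e * (h i + h l))"
      by (simp add: algebra_simps)
    ultimately have "e * (h j - h l) = 0" by simp
    moreover have "h j \<noteq> h l" using h that by (auto simp: inj_on_def)
    ultimately show ?thesis by simp
  qed
  have b0: "b = 0" if "i < 4" "j < 4" "i \<noteq> j" "y i = 0" "y j = 0" "e = 0" for i j
    using roots2[OF that(1-5)] that(6) by simp
  have y4: "y 4 = 0 \<longleftrightarrow> e = 0" and y5: "y 5 = 0 \<longleftrightarrow> b = 0" by (simp_all add: y)
  have small: "x < 4" if "x < 6" "x \<noteq> 4" "x \<noteq> 5" for x :: nat using that by auto
  have e: "e = 0"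
  proof (cases "4 \<in> {i, j, l}")
    case True
    then show ?thesis using ijl y4 by auto
  next
    case no4: False
    show ?thesis
    proof (cases "5 \<in> {i, j, l}")
      case True
      then have b: "b = 0" using ijl y5 by auto
      from True consider "i = 5" | "j = 5" | "l = 5" by auto
      then show ?thesis
      proof cases
        case 1
        then show ?thesis using e0[of j l] b no4 ijl small by auto
      next
        case 2
        then show ?thesis using e0[of i l] b no4 ijl small by auto
      next
        case 3
        then show ?thesis using e0[of i j] b no4 ijl small by auto
      qed
    next
      case False
      then show ?thesis using e3[of i j l] no4 ijl small by auto
    qed
  qed
  have b: "b = 0"
  proof (cases "5 \<in> {i, j, l}")
    case True
    then show ?thesis using ijl y5 by auto
  next
    case no5: False
    \<comment> \<open>At most one of three distinct indices is 4, so two lie on the conic part below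
      4.\<close>
    consider "i \<noteq> 4" "j \<noteq> 4" | "i \<noteq> 4" "l \<noteq> 4" | "j \<noteq> 4" "l \<noteq> 4" using ijl(1-3) by auto
    then show ?thesis
    proof cases
      case 1
      then show ?thesis using b0[of i j] e no5 ijl small by auto
    next
      case 2
      then show ?thesis using b0[of i l] e no5 ijl small by auto
    next
      case 3
      then show ?thesis using b0[of j l] e no5 ijl small by auto
    qed
  qed
  \<comment> \<open>Only 4 and 5 lie outside the conic part, so one of the three zeros is below 4
    and reads off \<open>a\<close>.\<close>
  consider "i < 4" | "j < 4" | "l < 4" using ijl(1-6) by linarith
  then have "a = 0" using a0 b e ijl(7-9) by cases auto
  then show False using nz b e by simp
qed

text \<open>Evaluates polynomials \<open>a + b X + e X^2\<close> at all four field elements and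
  appends the coefficients \<open>e\<close> and \<open>b\<close>.\<close>

lemma hyperoval_mds_on:
  assumes q: "CARD('a::field) = 4"
  shows "\<exists>C :: (nat \<Rightarrow> 'a) set. mds_on {..<6} 3 C"
proof -
  have fin: "finite (UNIV :: 'a set)" using q by (simp add: card_ge_0_finite)
  obtain h :: "nat \<Rightarrow> 'a" where h: "inj_on h {..<4}"
    using ex_bij_betw_nat_finite[OF fin] q by (auto simp: bij_betw_def lessThan_atLeast0)
  define g :: "'a \<times> 'a \<times> 'a \<Rightarrow> nat \<Rightarrow> 'a" where "g = (\<lambda>(a, b, e) j.
    if j < 4 then a + b * h j + e * (h j)^2 else if j = 4 then e else if j = 5 then b else 0)"
  have g_add: "g (a, b, e) + g (a', b', e') = g (a + a', b + b', e + e')" for a b e a' b' e'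
    by (auto simp: g_def fun_eq_iff algebra_simps)
  have g_scale: "scale_word c (g (a, b, e)) = g (c * a, c * b, c * e)" for c a b e
    by (auto simp: g_def fun_eq_iff algebra_simps)
  have g_0: "g (0, 0, 0) = 0" by (auto simp: g_def fun_eq_iff)
  have "inj g"
  proof (rule injI, clarsimp)
    fix a b e a' b' e' assume eq: "g (a, b, e) = g (a', b', e')"
    \<comment> \<open>Coordinates 4 and 5 return \<open>e\<close> and \<open>b\<close>; coordinate 0
      then returns \<open>a\<close>.\<close>
    show "a = a' \<and> b = b' \<and> e = e'"
      using fun_cong[OF eq, of 0] fun_cong[OF eq, of 4] fun_cong[OF eq, of 5] by (simp add: g_def)
  qed
  then have "card (range g) = CARD('a \<times> 'a \<times> 'a)" by (rule card_image)
  then have "card (range g) = CARD('a) ^ 3" by (simp add: power3_eq_cube)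
  moreover have "word_space.subspace (range g)"
    unfolding word_space.subspace_def
  proof (intro conjI ballI allI)
    show "0 \<in> range g" using g_0 by (metis rangeI)
    show "x + y \<in> range g" if "x \<in> range g" "y \<in> range g" for x y
      using that g_add by auto
    show "scale_word c x \<in> range g" if "x \<in> range g" for c x
      using that g_scale by auto
  qed
  moreover have "card {j \<in> {..<6}. x j = 0} < 3" if x: "x \<in> range g" "x \<noteq> 0" for x
  proof -
    obtain a b e where x': "x = g (a, b, e)" using x(1) by auto
    then have "(a, b, e) \<noteq> (0, 0, 0)" using x(2) g_0 by metis
    then show ?thesis
      using hyperoval_zeros[OF card_4_char_2[OF q] h] x' by (simp add: g_def)
  qed
  moreover have "finite (range g)" using calculation(1) q by (intro card_ge_0_finite) simp
  ultimately show ?thesis by (intro exI[of _ "range g"]) (simp add: mds_on_def)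
qed

section \<open>Optimality at r = 1 and the classification of parameters\<close>

text \<open>At r = 1 the ceiling is \<open>k\<close>; \<open>1 \<le> k\<close> keeps the natural
  subtraction exact.\<close>

lemma d_optimal_1_iff:
  assumes "1 \<le> k" "1 \<le> \<delta>"
  shows "d_optimal n k d 1 \<delta> \<longleftrightarrow> n = d + (k - 1) * \<delta>"
proof -
  have "d_optimal n k d 1 \<delta> \<longleftrightarrow> int n = int d + (int k - 1) * int \<delta>"
    by (auto simp: d_optimal_def algebra_simps)
  also have "(int k - 1) * int \<delta> = int ((k - 1) * \<delta>)" using assms by (simp add: of_nat_diff)
  finally show ?thesis unfolding of_nat_add[symmetric] of_nat_eq_iff .
qed

text \<open>r-optimality is vacuous, as no r' satisfies 1 <= r' < 1; \<open>k \<le> m\<close> makes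
  the distance at least \<open>\<delta>\<close>.\<close>

lemma mds_on_imp_optimal:
  fixes C :: "(nat \<Rightarrow> 'a::field) set"
  assumes q: "finite (UNIV :: 'a set)" and C: "mds_on {..<m} k C"
    and k: "2 \<le> k" "k \<le> m" and \<delta>: "2 < \<delta>"
  shows "\<exists>C :: (nat \<Rightarrow> 'a) set. optimal_LRC_code (m * \<delta>) k ((m - k + 1) * \<delta>) 1 \<delta> C"
proof -
  obtain C' :: "(nat \<Rightarrow> 'a) set" where "LRC_code (m * \<delta>) k ((m - k + 1) * \<delta>) 1 \<delta> C'"
    using repeated_mds_code[OF q C, of \<delta>] k \<delta> by auto
  moreover have "m * \<delta> = (m - k + 1) * \<delta> + (k - 1) * \<delta>"
    unfolding distrib_right[symmetric] using k by simp
  then have "d_optimal (m * \<delta>) k ((m - k + 1) * \<delta>) 1 \<delta>"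
    using k \<delta> by (subst d_optimal_1_iff) auto
  ultimately have "optimal_LRC_code (m * \<delta>) k ((m - k + 1) * \<delta>) 1 \<delta> C'"
    using k \<delta> by (simp add: optimal_LRC_code_def r_optimal_def)
  then show ?thesis by blast
qed

lemma optimal_imp_mds_on:
  fixes C :: "(nat \<Rightarrow> 'a::field) set"
  assumes q: "finite (UNIV :: 'a set)" and C: "optimal_LRC_code n k d 1 \<delta> C" and k: "2 \<le> k"
  shows "\<exists>J. n = card J * \<delta> \<and> k \<le> card J \<and> d = (card J - k + 1) * \<delta> \<and> mds_on J k C"
proof -
  have \<delta>: "2 < \<delta>" and sub: "word_space.subspace C" and CI: "C \<subseteq> words {1..n}"
    and dim: "word_space.dim C = k" and d: "min_dist_ge C d" and loc: "has_locality n 1 \<delta> C"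
    and opt: "d_optimal n k d 1 \<delta>"
    using C by (auto simp: optimal_LRC_code_def LRC_code_def nkd_code_def linear_code_def min_dist_eq_def)
  have n: "n = d + (k - 1) * \<delta>" using opt k \<delta> by (subst (asm) d_optimal_1_iff) auto
  have "finite C" using CI card_words(1)[OF q, of "{1..n}"] finite_subset by auto
  then have "card C = CARD('a) ^ k" using card_subspace[OF q sub] dim by simp
  then obtain J where J: "n = card J * \<delta>" "k \<le> card J" "mds_on J k C"
    using optimal_code_structure[OF q sub CI _ d loc n k] \<delta> by auto
  have "(card J - k + 1) * \<delta> + (k - 1) * \<delta> = card J * \<delta>"
    unfolding distrib_right[symmetric] using J(2) k by simp
  then have "d = (card J - k + 1) * \<delta>" using n J(1) by linarith
  then show ?thesis using J by blast
qed

theorem mainTheorem3: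
  fixes n k d \<delta> :: nat
  assumes "CARD('a::field) = 4"
    and "\<delta> > 2" and "k \<ge> 2" and "d \<ge> 5"
  shows "(\<exists>C :: (nat \<Rightarrow> 'a) set. optimal_LRC_code n k d 1 \<delta> C) \<longleftrightarrow>
      (n = k * \<delta> \<and> k \<ge> 2 \<and> d = \<delta> \<and> \<delta> \<ge> 5)
    \<or> (n = (k + 1) * \<delta> \<and> k \<ge> 2 \<and> d = 2 * \<delta> \<and> \<delta> > 2)
    \<or> (n = (k + 2) * \<delta> \<and> 2 \<le> k \<and> k \<le> 3 \<and> d = 3 * \<delta> \<and> \<delta> > 2)
    \<or> (n = (k + 3) * \<delta> \<and> 2 \<le> k \<and> k \<le> 3 \<and> d = 4 * \<delta> \<and> \<delta> > 2)"
    (is "_ \<longleftrightarrow> ?R")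
proof
  have fin: "finite (UNIV :: 'a set)" using assms(1) by (simp add: card_ge_0_finite)
  {
    assume "\<exists>C :: (nat \<Rightarrow> 'a) set. optimal_LRC_code n k d 1 \<delta> C"
    then obtain C :: "(nat \<Rightarrow> 'a) set" and J where
      J: "n = card J * \<delta>" "k \<le> card J" "d = (card J - k + 1) * \<delta>" "mds_on J k C"
      using optimal_imp_mds_on[OF fin _ assms(3)] by blast
    \<comment> \<open>\<open>t\<close> is the redundancy of the MDS code, so
      \<open>d = (t + 1) * \<delta>\<close>; the four cases are \<open>t\<close> = 0, 1, 2,
      3.\<close>
    obtain t where t: "card J = k + t" using J(2) le_Suc_ex by blast
    have "t \<le> 3 \<and> (t \<ge> 2 \<longrightarrow> k \<le> 3)"
    proof -
      consider "k = 2" | "k = 3" | "k \<ge> 4" using assms(3) by linarith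
      then show ?thesis
        using mds_on_dim_2_length[OF assms(1), of J C] mds_on_dim_3_length[OF assms(1), of J C]
          mds_on_length[OF assms(1) J(4)] J(4) t by cases auto
    qed
    then have "t \<in> {0, 1} \<or> t \<in> {2, 3} \<and> k \<le> 3" by auto
    \<comment> \<open>For \<open>t = 0\<close> the distance is \<open>\<delta>\<close>, so
      \<open>d \<ge> 5\<close> yields \<open>\<delta> \<ge> 5\<close>.\<close>
    then show ?R using J(1,3) t assms(2-4) by auto
  next
    assume R: ?R
    have *: "\<exists>C :: (nat \<Rightarrow> 'a) set. optimal_LRC_code n k d 1 \<delta> C"
      if "\<exists>C :: (nat \<Rightarrow> 'a) set. mds_on {..<k + t} k C" "n = (k + t) * \<delta>" "d = (t + 1) * \<delta>" for t
      using mds_on_imp_optimal[OF fin, of "k + t" k] that assms(2,3) by auto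
    \<comment> \<open>The parity code has length \<open>k + 1\<close>; puncturing it covers
      \<open>t = 0\<close>.\<close>
    have P: "\<exists>C :: (nat \<Rightarrow> 'a) set. mds_on {..<k + t} k C" if "t \<le> 1" for t
      using parity_mds_on[OF fin, of k] mds_on_mono[of "{..<Suc k}" k] that
      by (metis Suc_eq_plus1 add_le_mono lessThan_subset_iff order_refl)
    obtain H :: "(nat \<Rightarrow> 'a) set" where H: "mds_on {..<6} 3 H"
      using hyperoval_mds_on[OF assms(1)] by blast
    have "mds_on ({..<6} - {5}) 2 {x \<in> H. x 5 = 0}"
      using H by (intro mds_on_shorten[OF fin]) (simp_all add: eval_nat_numeral)
    moreover have "{..<6} - {5} = {..<5 :: nat}" by auto
    ultimately have H': "mds_on {..<5} 2 {x \<in> H. x 5 = 0}" by simp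
    \<comment> \<open>Lengths 6 for \<open>k = 3\<close> and 5 for \<open>k = 2\<close> are both
      \<open>k + 3\<close>; smaller \<open>t\<close> follows by puncturing.\<close>
    have Q: "\<exists>C :: (nat \<Rightarrow> 'a) set. mds_on {..<k + t} k C" if "t \<le> 3" "k \<le> 3" for t
    proof -
      have "k = 2 \<or> k = 3" using assms(3) that by auto
      then show ?thesis
        using mds_on_mono[OF H, of "{..<k + t}"] mds_on_mono[OF H', of "{..<k + t}"] that by auto
    qed
    from R show "\<exists>C :: (nat \<Rightarrow> 'a) set. optimal_LRC_code n k d 1 \<delta> C"
      using *[OF P[of 0]] *[OF P[of 1]] *[OF Q[of 2]] *[OF Q[of 3]] by (elim disjE) simp_all
  }
qed

end
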